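(* Let $s\ge2$, $\eta=0.15$, and consider the $s$-stage RKC scheme of order two (in the formulation below) applied to the optimal control problem $\min_u\Psi(y(T))$, $\dot y=f(u,y)$, $y(0)=y^0$, i.e. minimize $\Psi(y_N)$ subject to $y_0=y^0$ and, for $k=0,\dots,N-1$, $$y_{k0}=y_k,\quad y_{k1}=y_{k0}+\mu_1hf(u_{k0},y_{k0}),$$ $$y_{ki}=\mu_ihf(u_{k,i-1},y_{k,i-1})+\nu_iy_{k,i-1}+(1-\nu_i)y_{k,i-2}\ (i=2,\dots,s),\quad y_{k+1}=a_sy_{k0}+b_sT_s(\omega_0)y_{ks},$$ with the coefficients given in the context. Define $\alpha_s=b_sT_s(\omega_0)$, $\alpha_{s-1}=\nu_s\alpha_s$, and $\alpha_{s-j}=\nu_{s-j+1}\alpha_{s-j+1}+(1-\nu_{s-j+2})\alpha_{s-j+2}$ for $j=2,\dots,s-1$. Then the double adjoint of this scheme (see context) is given by the recurrence, for $k=N-1,\dots,1,0$, $$p_N=\nabla\Psi(y_N),\qquad p_{ks}=p_{k+1},$$ $$p_{k,s-1}=p_{ks}+\frac{\mu_s}{\nu_s}h\nabla_yH(u_{k,s-1},y_{k,s-1},p_{ks}),$$ $$p_{k,s-j}=\frac{\mu_{s-j+1}\alpha_{s-j+1}}{\alpha_{s-j}}h\nabla_yH(u_{k,s-j},y_{k,s-j},p_{k,s-j+1})+\frac{\nu_{s-j+1}\alpha_{s-j+1}}{\alpha_{s-j}}p_{k,s-j+1}+\frac{(1-\nu_{s-j+2})\alpha_{s-j+2}}{\alpha_{s-j}}p_{k,s-j+2},\quad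 j=2,\dots,s-1,$$ $$p_{k0}=\mu_1\alpha_1h\nabla_yH(u_{k0},y_{k0},p_{k1})+\alpha_1p_{k1}+(1-\nu_2)\alpha_2p_{k2}+a_sp_{k+1},\qquad p_k=p_{k0},$$ $$\nabla_uH(u_{k,s-j},y_{k,s-j},p_{k,s-j+1})=0,\quad j=1,\dots,s.$$
   Context: Setting: $T>0$, $N\in\mathbb N$, $h=T/N$, $y^0\in\mathbb R^n$; $f:\mathbb R^m\times\mathbb R^n\to\mathbb R^n$ and $\Psi:\mathbb R^n\to\mathbb R$ are $C^\infty$. The pseudo-Hamiltonian is $H(u,y,p)=p^Tf(u,y)$, so $\nabla_yH(u,y,p)=(\partial f/\partial y(u,y))^Tp$. RKC coefficients: $T_j$ denotes the Chebyshev polynomial, $T_j(\cos\theta)=\cos(j\theta)$. Set $\omega_0=1+\eta/s^2$, $\omega_2=T_s'(\omega_0)/T_s''(\omega_0)$, $b_s=T_s''(\omega_0)/(T_s'(\omega_0))^2$, $a_s=1-b_sT_s(\omega_0)$, $\mu_1=\omega_2/\omega_0$, and for $i=2,\dots,s$: $\mu_i=2\omega_2T_{i-1}(\omega_0)/T_i(\omega_0)$, $\nu_i=2\omega_0T_{i-1}(\omega_0)/T_i(\omega_0)$. Double adjoint: a Runge-Kutta method with coefficients $(a_{ij},w_i)_{i,j=1,\dots,s}$ and all $w_i\ne0$ has as double adjoint the Runge-Kutta method with coefficients $(\tilde a_{ij},\tilde w_i)=\left(\frac{w_j}{w_i}a_{ji},\,w_i\right)$, applied to the costate equation backward in time. Concretely,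 a scheme whose stages $y_{k0},\dots,y_{k,s-1}$ are written in Runge-Kutta form $y_{k,i-1}=y_k+h\sum_{j=1}^sa_{ij}f(u_{k,j-1},y_{k,j-1})$ ($i=1,\dots,s$), $y_{k+1}=y_k+h\sum_{i=1}^sw_if(u_{k,i-1},y_{k,i-1})$ has as double adjoint the costate discretization, for $k=N-1,\dots,0$, $$p_N=\nabla\Psi(y_N),\quad p_k=p_{k+1}+h\sum_{i=1}^sw_i\nabla_yH(u_{k,i-1},y_{k,i-1},p_{k,i}),$$ $$p_{k,i}=p_{k+1}+h\sum_{j=1}^s\frac{w_j}{w_i}a_{ji}\nabla_yH(u_{k,j-1},y_{k,j-1},p_{k,j}),\quad i=1,\dots,s,$$ coupled with the conditions $\nabla_uH(u_{k,i-1},y_{k,i-1},p_{k,i})=0$, $i=1,\dots,s$. (The costate stage associated with the state stage $y_{k,i-1}$ is labelled $p_{k,i}$.) "Is given by the recurrence" means that the recurrence produces exactly the same values $p_k$ and stages $p_{k,1},\dots,p_{k,s}$ as this double adjoint. *)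

theory Defs
  imports "HOL-Analysis.Analysis" "HOL-Computational_Algebra.Polynomial"
begin

section \<open>Smoothness and gradients\<close>

text \<open>
  \<open>C_diff k g\<close>: all iterated directional derivatives of \<open>g\<close> up to order \<open>k - 1\<close> are
  Frechet differentiable everywhere, and those of order \<open>k\<close> are continuous; in finite
  dimension this is the usual class $C^k$.
\<close>

fun C_diff :: "nat \<Rightarrow> ('a::euclidean_space \<Rightarrow> 'b::real_normed_vector) \<Rightarrow> bool" where
  "C_diff 0 g \<longleftrightarrow> continuous_on UNIV g"
| "C_diff (Suc k) g \<longleftrightarrow>
     (\<forall>x. g differentiable (at x)) \<and> (\<forall>v. C_diff k (\<lambda>x. frechet_derivative g (at x) v))"

definition smooth :: "('a::euclidean_space \<Rightarrow> 'b::real_normed_vector) \<Rightarrow> bool" where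
  "smooth g \<longleftrightarrow> (\<forall>k. C_diff k g)"

definition gradient :: "('a::euclidean_space \<Rightarrow> real) \<Rightarrow> 'a \<Rightarrow> 'a" where
  "gradient g x = (THE D. GDERIV g x :> D)"

lemma gradient_eqI:
  fixes g :: "'a::euclidean_space \<Rightarrow> real"
  assumes "GDERIV g x :> D"
  shows "gradient g x = D"
  unfolding gradient_def
proof (rule the_equality)
  fix D' assume "GDERIV g x :> D'"
  with assms have "(\<lambda>h. inner h D') = (\<lambda>h. inner h D)"
    unfolding gderiv_def by (rule has_derivative_unique[rotated])
  then show "D' = D" by (metis inner_commute vector_eq_rdot)
qed (rule assms)

section \<open>The pseudo-Hamiltonian\<close>

definition Ham ::
  "((real^'m) \<times> (real^'n) \<Rightarrow> real^'n) \<Rightarrow> real^'m \<Rightarrow> real^'n \<Rightarrow> real^'n \<Rightarrow> real" where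
  "Ham f u y p = p \<bullet> f (u, y)"

definition grad_u_Ham ::
  "((real^'m) \<times> (real^'n) \<Rightarrow> real^'n) \<Rightarrow> real^'m \<Rightarrow> real^'n \<Rightarrow> real^'n \<Rightarrow> real^'m" where
  "grad_u_Ham f u y p = gradient (\<lambda>v. Ham f v y p) u"

definition grad_y_Ham ::
  "((real^'m) \<times> (real^'n) \<Rightarrow> real^'n) \<Rightarrow> real^'m \<Rightarrow> real^'n \<Rightarrow> real^'n \<Rightarrow> real^'n" where
  "grad_y_Ham f u y p = gradient (\<lambda>z. Ham f u z p) y"

section \<open>Chebyshev polynomials and the RKC coefficients\<close>

definition cheb :: "nat \<Rightarrow> real poly" where
  "cheb j = (THE P. \<forall>\<theta>. poly P (cos \<theta>) = cos (real j * \<theta>))"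

lemma cheb_exists: "\<exists>P::real poly. \<forall>\<theta>. poly P (cos \<theta>) = cos (real j * \<theta>)"
proof (induction j rule: induct_nat_012)
  case 0
  show ?case by (rule exI[of _ 1]) simp
next
  case 1
  show ?case by (rule exI[of _ "[:0, 1:]"]) simp
next
  case (ge2 j)
  then obtain P Q :: "real poly"
    where P: "\<And>\<theta>. poly P (cos \<theta>) = cos (real j * \<theta>)"
      and Q: "\<And>\<theta>. poly Q (cos \<theta>) = cos (real (Suc j) * \<theta>)"
    by blast
  have "poly ([:0, 2:] * Q - P) (cos \<theta>) = cos (real (Suc (Suc j)) * \<theta>)" for \<theta>
  proof -
    have "cos (real (Suc j) * \<theta> + \<theta>) + cos (real (Suc j) * \<theta> - \<theta>)
            = 2 * cos \<theta> * cos (real (Suc j) * \<theta>)"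
      by (simp add: cos_add cos_diff)
    moreover have "real (Suc j) * \<theta> + \<theta> = real (Suc (Suc j)) * \<theta>"
      and "real (Suc j) * \<theta> - \<theta> = real j * \<theta>"
      by (simp_all add: algebra_simps)
    ultimately show ?thesis by (simp add: P Q)
  qed
  then show ?case by blast
qed

lemma cheb_unique:
  fixes P Q :: "real poly"
  assumes "\<And>\<theta>. poly P (cos \<theta>) = poly Q (cos \<theta>)"
  shows "P = Q"
proof (rule ccontr)
  assume "P \<noteq> Q"
  then have "finite {x. poly (P - Q) x = 0}"
    by (intro poly_roots_finite) simp
  moreover have "{-1..1::real} \<subseteq> {x. poly (P - Q) x = 0}"
  proof
    fix x :: real assume "x \<in> {-1..1}"
    then have "cos (arccos x) = x" by simp
    then show "x \<in> {x. poly (P - Q) x = 0}"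
      using assms[of "arccos x"] by simp
  qed
  ultimately have "finite {-1..1::real}" by (rule finite_subset[rotated])
  then show False using infinite_Icc[of "-1::real" 1] by simp
qed

lemma cheb_cos: "poly (cheb j) (cos \<theta>) = cos (real j * \<theta>)"
proof -
  have "\<exists>!P::real poly. \<forall>\<theta>. poly P (cos \<theta>) = cos (real j * \<theta>)"
    using cheb_exists[of j] by (auto intro!: cheb_unique)
  from theI'[OF this] show ?thesis unfolding cheb_def by blast
qed

definition \<omega>\<^sub>0 :: "nat \<Rightarrow> real \<Rightarrow> real" where
  "\<omega>\<^sub>0 s \<eta> = 1 + \<eta> / (real s)\<^sup>2"

definition chebT :: "nat \<Rightarrow> real \<Rightarrow> nat \<Rightarrow> real" where
  "chebT s \<eta> j = poly (cheb j) (\<omega>\<^sub>0 s \<eta>)"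

definition chebT' :: "nat \<Rightarrow> real \<Rightarrow> real" where
  "chebT' s \<eta> = poly (pderiv (cheb s)) (\<omega>\<^sub>0 s \<eta>)"

definition chebT'' :: "nat \<Rightarrow> real \<Rightarrow> real" where
  "chebT'' s \<eta> = poly (pderiv (pderiv (cheb s))) (\<omega>\<^sub>0 s \<eta>)"

definition \<omega>\<^sub>2 :: "nat \<Rightarrow> real \<Rightarrow> real" where
  "\<omega>\<^sub>2 s \<eta> = chebT' s \<eta> / chebT'' s \<eta>"

definition rkc_b :: "nat \<Rightarrow> real \<Rightarrow> real" where
  "rkc_b s \<eta> = chebT'' s \<eta> / (chebT' s \<eta>)\<^sup>2"

definition rkc_a :: "nat \<Rightarrow> real \<Rightarrow> real" where
  "rkc_a s \<eta> = 1 - rkc_b s \<eta> * chebT s \<eta> s"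

definition rkc_\<mu> :: "nat \<Rightarrow> real \<Rightarrow> nat \<Rightarrow> real" where
  "rkc_\<mu> s \<eta> i =
     (if i = 1 then \<omega>\<^sub>2 s \<eta> / \<omega>\<^sub>0 s \<eta>
      else 2 * \<omega>\<^sub>2 s \<eta> * chebT s \<eta> (i - 1) / chebT s \<eta> i)"

definition rkc_\<nu> :: "nat \<Rightarrow> real \<Rightarrow> nat \<Rightarrow> real" where
  "rkc_\<nu> s \<eta> i = 2 * \<omega>\<^sub>0 s \<eta> * chebT s \<eta> (i - 1) / chebT s \<eta> i"

section \<open>The RKC scheme and Runge-Kutta form\<close>

text \<open>
  In all predicates below, \<open>y k\<close>, \<open>p k\<close> (\<open>k \<le> N\<close>) are the grid values and \<open>Y k i\<close>, \<open>u k i\<close>,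
  \<open>P k i\<close> (\<open>k < N\<close>) are the stage values.
\<close>

definition rkc_scheme ::
  "nat \<Rightarrow> real \<Rightarrow> ((real^'m) \<times> (real^'n) \<Rightarrow> real^'n) \<Rightarrow> nat \<Rightarrow> real \<Rightarrow> real^'n
   \<Rightarrow> (nat \<Rightarrow> nat \<Rightarrow> real^'m) \<Rightarrow> (nat \<Rightarrow> real^'n) \<Rightarrow> (nat \<Rightarrow> nat \<Rightarrow> real^'n) \<Rightarrow> bool" where
  "rkc_scheme s \<eta> f N h y\<^sub>0 u y Y \<longleftrightarrow>
     y 0 = y\<^sub>0 \<and>
     (\<forall>k<N.
        Y k 0 = y k \<and>
        Y k 1 = Y k 0 + (rkc_\<mu> s \<eta> 1 * h) *\<^sub>R f (u k 0, Y k 0) \<and>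
        (\<forall>i\<in>{2..s}. Y k i = (rkc_\<mu> s \<eta> i * h) *\<^sub>R f (u k (i - 1), Y k (i - 1))
                        + rkc_\<nu> s \<eta> i *\<^sub>R Y k (i - 1)
                        + (1 - rkc_\<nu> s \<eta> i) *\<^sub>R Y k (i - 2)) \<and>
        y (Suc k) = rkc_a s \<eta> *\<^sub>R Y k 0 + (rkc_b s \<eta> * chebT s \<eta> s) *\<^sub>R Y k s)"

text \<open>A Runge-Kutta method \<open>(A, w)\<close> whose \<open>i\<close>-th stage (\<open>1 \<le> i \<le> s\<close>) is labelled \<open>Y k (i - 1)\<close>.\<close>

definition rk_scheme ::
  "nat \<Rightarrow> (nat \<Rightarrow> nat \<Rightarrow> real) \<Rightarrow> (nat \<Rightarrow> real)
   \<Rightarrow> ((real^'m) \<times> (real^'n) \<Rightarrow> real^'n) \<Rightarrow> nat \<Rightarrow> real \<Rightarrow> real^'n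
   \<Rightarrow> (nat \<Rightarrow> nat \<Rightarrow> real^'m) \<Rightarrow> (nat \<Rightarrow> real^'n) \<Rightarrow> (nat \<Rightarrow> nat \<Rightarrow> real^'n) \<Rightarrow> bool" where
  "rk_scheme s A w f N h y\<^sub>0 u y Y \<longleftrightarrow>
     y 0 = y\<^sub>0 \<and>
     (\<forall>k<N.
        (\<forall>i\<in>{1..s}. Y k (i - 1) =
            y k + h *\<^sub>R (\<Sum>j=1..s. A i j *\<^sub>R f (u k (j - 1), Y k (j - 1)))) \<and>
        y (Suc k) = y k + h *\<^sub>R (\<Sum>i=1..s. w i *\<^sub>R f (u k (i - 1), Y k (i - 1))))"

text \<open>
  \<open>rkc_stage s \<eta> i j\<close> is the coefficient of \<open>h f (u k (j - 1), Y k (j - 1))\<close> in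
  \<open>Y k i - y k\<close> for the RKC scheme (\<open>0 \<le> i \<le> s\<close>); it is obtained by inserting this ansatz into
  the three-term recursion, whose weights \<open>\<nu>\<close> and \<open>1 - \<nu>\<close> add up to one.
\<close>

fun rkc_stage :: "nat \<Rightarrow> real \<Rightarrow> nat \<Rightarrow> nat \<Rightarrow> real" where
  "rkc_stage s \<eta> 0 j = 0"
| "rkc_stage s \<eta> (Suc 0) j = (if j = 1 then rkc_\<mu> s \<eta> 1 else 0)"
| "rkc_stage s \<eta> (Suc (Suc i)) j =
     (if j = i + 2 then rkc_\<mu> s \<eta> (i + 2) else 0)
     + rkc_\<nu> s \<eta> (i + 2) * rkc_stage s \<eta> (Suc i) j
     + (1 - rkc_\<nu> s \<eta> (i + 2)) * rkc_stage s \<eta> i j"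

definition rkc_A :: "nat \<Rightarrow> real \<Rightarrow> nat \<Rightarrow> nat \<Rightarrow> real" where
  "rkc_A s \<eta> i j = rkc_stage s \<eta> (i - 1) j"

definition rkc_w :: "nat \<Rightarrow> real \<Rightarrow> nat \<Rightarrow> real" where
  "rkc_w s \<eta> j = rkc_b s \<eta> * chebT s \<eta> s * rkc_stage s \<eta> s j"

section \<open>Double adjoint of a Runge-Kutta method\<close>

text \<open>Meaningful when all weights \<open>w i\<close>, \<open>1 \<le> i \<le> s\<close>, are nonzero.\<close>

definition double_adjoint_costate ::
  "nat \<Rightarrow> (nat \<Rightarrow> nat \<Rightarrow> real) \<Rightarrow> (nat \<Rightarrow> real)
   \<Rightarrow> ((real^'m) \<times> (real^'n) \<Rightarrow> real^'n) \<Rightarrow> (real^'n \<Rightarrow> real) \<Rightarrow> nat \<Rightarrow> real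
   \<Rightarrow> (nat \<Rightarrow> nat \<Rightarrow> real^'m) \<Rightarrow> (nat \<Rightarrow> real^'n) \<Rightarrow> (nat \<Rightarrow> nat \<Rightarrow> real^'n)
   \<Rightarrow> (nat \<Rightarrow> real^'n) \<Rightarrow> (nat \<Rightarrow> nat \<Rightarrow> real^'n) \<Rightarrow> bool" where
  "double_adjoint_costate s A w f \<Psi> N h u y Y p P \<longleftrightarrow>
     p N = gradient \<Psi> (y N) \<and>
     (\<forall>k<N.
        p k = p (Suc k)
              + h *\<^sub>R (\<Sum>i=1..s. w i *\<^sub>R grad_y_Ham f (u k (i - 1)) (Y k (i - 1)) (P k i)) \<and>
        (\<forall>i\<in>{1..s}. P k i = p (Suc k)
              + h *\<^sub>R (\<Sum>j=1..s. (w j / w i * A j i) *\<^sub>R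
                           grad_y_Ham f (u k (j - 1)) (Y k (j - 1)) (P k j))))"

definition double_adjoint_stationarity ::
  "nat \<Rightarrow> ((real^'m) \<times> (real^'n) \<Rightarrow> real^'n) \<Rightarrow> nat
   \<Rightarrow> (nat \<Rightarrow> nat \<Rightarrow> real^'m) \<Rightarrow> (nat \<Rightarrow> nat \<Rightarrow> real^'n) \<Rightarrow> (nat \<Rightarrow> nat \<Rightarrow> real^'n) \<Rightarrow> bool" where
  "double_adjoint_stationarity s f N u Y P \<longleftrightarrow>
     (\<forall>k<N. \<forall>i\<in>{1..s}. grad_u_Ham f (u k (i - 1)) (Y k (i - 1)) (P k i) = 0)"

section \<open>The RKC costate recurrence\<close>

definition rkc_costate_recurrence ::
  "nat \<Rightarrow> real \<Rightarrow> (nat \<Rightarrow> real)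
   \<Rightarrow> ((real^'m) \<times> (real^'n) \<Rightarrow> real^'n) \<Rightarrow> (real^'n \<Rightarrow> real) \<Rightarrow> nat \<Rightarrow> real
   \<Rightarrow> (nat \<Rightarrow> nat \<Rightarrow> real^'m) \<Rightarrow> (nat \<Rightarrow> real^'n) \<Rightarrow> (nat \<Rightarrow> nat \<Rightarrow> real^'n)
   \<Rightarrow> (nat \<Rightarrow> real^'n) \<Rightarrow> (nat \<Rightarrow> nat \<Rightarrow> real^'n) \<Rightarrow> bool" where
  "rkc_costate_recurrence s \<eta> \<alpha> f \<Psi> N h u y Y p P \<longleftrightarrow>
     p N = gradient \<Psi> (y N) \<and>
     (\<forall>k<N.
        P k s = p (Suc k) \<and>
        P k (s - 1) = P k s
          + (rkc_\<mu> s \<eta> s / rkc_\<nu> s \<eta> s * h) *\<^sub>R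
              grad_y_Ham f (u k (s - 1)) (Y k (s - 1)) (P k s) \<and>
        (\<forall>j\<in>{2..s-1}. P k (s - j) =
            (rkc_\<mu> s \<eta> (s - j + 1) * \<alpha> (s - j + 1) / \<alpha> (s - j) * h) *\<^sub>R
              grad_y_Ham f (u k (s - j)) (Y k (s - j)) (P k (s - j + 1))
          + (rkc_\<nu> s \<eta> (s - j + 1) * \<alpha> (s - j + 1) / \<alpha> (s - j)) *\<^sub>R P k (s - j + 1)
          + ((1 - rkc_\<nu> s \<eta> (s - j + 2)) * \<alpha> (s - j + 2) / \<alpha> (s - j)) *\<^sub>R P k (s - j + 2)) \<and>
        P k 0 =
            (rkc_\<mu> s \<eta> 1 * \<alpha> 1 * h) *\<^sub>R grad_y_Ham f (u k 0) (Y k 0) (P k 1)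
          + \<alpha> 1 *\<^sub>R P k 1
          + ((1 - rkc_\<nu> s \<eta> 2) * \<alpha> 2) *\<^sub>R P k 2
          + rkc_a s \<eta> *\<^sub>R p (Suc k) \<and>
        p k = P k 0)"

definition rkc_stationarity ::
  "nat \<Rightarrow> ((real^'m) \<times> (real^'n) \<Rightarrow> real^'n) \<Rightarrow> nat
   \<Rightarrow> (nat \<Rightarrow> nat \<Rightarrow> real^'m) \<Rightarrow> (nat \<Rightarrow> nat \<Rightarrow> real^'n) \<Rightarrow> (nat \<Rightarrow> nat \<Rightarrow> real^'n) \<Rightarrow> bool" where
  "rkc_stationarity s f N u Y P \<longleftrightarrow>
     (\<forall>k<N. \<forall>j\<in>{1..s}. grad_u_Ham f (u k (s - j)) (Y k (s - j)) (P k (s - j + 1)) = 0)"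

end

theory Submission
  imports Defs
begin

text \<open>
  The RKC scheme is a linear three-term recursion driven by the stage values of \<open>f\<close>, so everything
  is governed by its impulse response: \<open>C r j = impulse \<nu> r j\<close> is the effect on stage \<open>r\<close> of a unit impulse
  injected at stage \<open>j\<close>. An impulse \<open>\<mu> j h f\<close> enters at stage \<open>j\<close>, hence the Runge-Kutta
  coefficients are \<open>\<mu> j * C r j\<close>.

  By definition \<open>C\<close> satisfies the three-term recursion in its row index (the stage that is
  observed). It also satisfies a three-term recursion in its column index (the stage of injection):
  an impulse at stage \<open>i\<close> acts from then on like impulses of sizes \<open>\<nu> (i + 1)\<close> and
  \<open>1 - \<nu> (i + 2)\<close> at the next two stages (\<open>impulse_column_recursion\<close>; for \<open>i = 0\<close> the first
  of these sizes is \<open>1\<close>). The column recursion is the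
  one that defines \<open>\<alpha>\<close>, so \<open>\<alpha> i = \<alpha> s * C s i\<close>: the number \<open>\<alpha> i\<close> is the sensitivity of
  \<open>y (k + 1)\<close> to a perturbation of stage \<open>i\<close>, and the Runge-Kutta weights are
  \<open>w i = \<mu> i * \<alpha> i\<close>. After multiplication by \<open>\<alpha> i\<close>, the \<open>i\<close>-th stage of the double adjoint becomes
  \<open>\<alpha> i p + h (\<Sum>j. w j C (j - 1) i g j)\<close> with \<open>p = p (k + 1)\<close> and \<open>g j\<close> the value of
  \<open>\<nabla>\<^sub>y H\<close> at stage \<open>j\<close>. This depends on \<open>i\<close> only through columns of \<open>C\<close>, so the column recursion
  turns into the costate recurrence, the driving term coming from the diagonal entry of \<open>C\<close>.
  Conversely, the recurrence with its starting value determines all stages, because every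
  \<open>\<alpha> i\<close> can be divided by. This is an identity between linear expressions in the \<open>g j\<close> that
  holds for arbitrary vectors, so it applies although the actual \<open>g j\<close> depend on the costate
  stages (\<open>stages_eq_scaled_costate_iff\<close>, \<open>rkc_adjoint_step_iff\<close>).

  It remains to see that the weights do not vanish. At \<open>\<omega>\<^sub>0 \<ge> 1\<close> the Chebyshev polynomials and
  their first two derivatives are nondecreasing in the degree, and positive as soon as the degree is
  at least the order of the derivative; so \<open>\<mu> i\<close> and \<open>\<alpha> s\<close> are positive. The quotients
  \<open>\<beta> i = \<alpha> i / T\<^sub>i(\<omega>\<^sub>0)\<close> obey the Chebyshev recursion \<open>\<beta> i = 2 \<omega>\<^sub>0 \<beta> (i + 1) - \<beta> (i + 2)\<close> in
  the direction of decreasing \<open>i\<close> (they are multiples of the values at \<open>\<omega>\<^sub>0\<close> of the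
  second-kind polynomials of degree \<open>s - i\<close>), which keeps them positive (\<open>rkc_alpha_pos\<close>).
\<close>

section \<open>Impulse responses of three-term recursions\<close>

text \<open>
  The first step of the recursion has the single weight \<open>1\<close>, which is why row \<open>1\<close> is given
  separately. An impulse at stage \<open>0\<close> is a change of the initial value.
\<close>

fun impulse :: "(nat \<Rightarrow> real) \<Rightarrow> nat \<Rightarrow> nat \<Rightarrow> real" where
  "impulse \<nu> 0 j = (if j = 0 then 1 else 0)"
| "impulse \<nu> (Suc 0) j = (if j \<le> 1 then 1 else 0)"
| "impulse \<nu> (Suc (Suc r)) j =
     (if j = r + 2 then 1 else 0)
     + \<nu> (r + 2) * impulse \<nu> (Suc r) j + (1 - \<nu> (r + 2)) * impulse \<nu> r j"

lemma impulse_eq_0: "r < j \<Longrightarrow> impulse \<nu> r j = 0"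
  by (induction \<nu> r j rule: impulse.induct) auto

lemma impulse_diag: "impulse \<nu> r r = 1"
  by (cases "(\<nu>, r, r)" rule: impulse.cases) (auto simp: impulse_eq_0)

text \<open>The weights add up to one, so constants propagate unchanged.\<close>

lemma impulse_0: "impulse \<nu> r 0 = 1"
  by (induction r rule: induct_nat_012) auto

text \<open>
  The stages that see an impulse at \<open>i\<close> directly are \<open>i + 1\<close> and \<open>i + 2\<close>, with the weights of the
  recursion at these stages; after that only these two perturbations propagate. Formally both sides
  satisfy the same row recursion and the Kronecker terms agree.
\<close>

lemma impulse_column_recursion:
  assumes "i \<ge> 1"
  shows "impulse \<nu> r i = (if r = i then 1 else 0)
           + \<nu> (i + 1) * impulse \<nu> r (i + 1) + (1 - \<nu> (i + 2)) * impulse \<nu> r (i + 2)"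
  using assms
proof (induction r rule: induct_nat_012)
  case (ge2 r)
  note IH = ge2.IH(1)[OF ge2.prems] ge2.IH(2)[OF ge2.prems]
  show ?case
    unfolding impulse.simps(3) IH(1) IH(2) by (auto simp: algebra_simps)
qed auto

text \<open>For the initial value, the first of the two weights is \<open>1\<close> instead of \<open>\<nu> 1\<close>.\<close>

lemma impulse_column_recursion_0:
  "1 = (if r = 0 then 1 else 0) + impulse \<nu> r 1 + (1 - \<nu> 2) * impulse \<nu> r 2"
proof (induction r rule: induct_nat_012)
  case (ge2 r)
  have "1 = \<nu> (r + 2) * 1 + (1 - \<nu> (r + 2)) * (1::real)" by simp
  also have "\<dots> = \<nu> (r + 2) *
        ((if Suc r = 0 then 1 else 0) + impulse \<nu> (Suc r) 1 + (1 - \<nu> 2) * impulse \<nu> (Suc r) 2)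
      + (1 - \<nu> (r + 2)) *
        ((if r = 0 then 1 else 0) + impulse \<nu> r 1 + (1 - \<nu> 2) * impulse \<nu> r 2)"
    by (simp only: ge2.IH[symmetric])
  finally show ?case by (auto simp: algebra_simps numeral_2_eq_2)
qed auto

text \<open>
  Since the column recursion determines the last row of \<open>C\<close> from its diagonal entry, any solution of
  the recursion, read backward from stage \<open>s\<close>, is a multiple of that row.
\<close>

lemma backward_recursion_eq_impulse:
  assumes last: "\<alpha> (s - 1) = \<nu> s * \<alpha> s"
    and rec: "\<And>i. 1 \<le> i \<Longrightarrow> i + 2 \<le> s \<Longrightarrow>
        \<alpha> i = \<nu> (i + 1) * \<alpha> (i + 1) + (1 - \<nu> (i + 2)) * \<alpha> (i + 2)"
    and "1 \<le> i" "i \<le> s"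
  shows "\<alpha> i = \<alpha> s * impulse \<nu> s i"
  using \<open>1 \<le> i\<close> \<open>i \<le> s\<close>
proof (induction "s - i" arbitrary: i rule: less_induct)
  case less
  consider "i = s" | "i + 1 = s" | "i + 2 \<le> s" using less.prems by linarith
  then show ?case
  proof cases
    case 1
    then show ?thesis by (simp add: impulse_diag)
  next
    case 2
    have "impulse \<nu> s i = \<nu> s"
      using impulse_column_recursion[OF less.prems(1), of \<nu> s] 2
      by (auto simp: impulse_diag impulse_eq_0)
    then show ?thesis using last 2 by auto
  next
    case 3
    have "\<alpha> (i + 1) = \<alpha> s * impulse \<nu> s (i + 1)" "\<alpha> (i + 2) = \<alpha> s * impulse \<nu> s (i + 2)"
      using less.hyps[of "i + 1"] less.hyps[of "i + 2"] 3 by auto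
    moreover have
      "impulse \<nu> s i = \<nu> (i + 1) * impulse \<nu> s (i + 1) + (1 - \<nu> (i + 2)) * impulse \<nu> s (i + 2)"
      using impulse_column_recursion[OF less.prems(1), of \<nu> s] 3 by simp
    ultimately show ?thesis
      unfolding rec[OF less.prems(1) 3] by (simp only: distrib_left mult.left_commute)
  qed
qed

text \<open>Superposition: each stage is the initial value plus the responses to all earlier impulses.\<close>

lemma three_term_superposition:
  fixes Y F :: "nat \<Rightarrow> 'v::real_vector"
  assumes Y1: "Y 1 = Y 0 + (\<mu> 1 * h) *\<^sub>R F 1"
    and Y2: "\<And>i. i \<in> {2..s} \<Longrightarrow>
        Y i = (\<mu> i * h) *\<^sub>R F i + \<nu> i *\<^sub>R Y (i - 1) + (1 - \<nu> i) *\<^sub>R Y (i - 2)"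
    and "i \<le> s"
  shows "Y i = Y 0 + h *\<^sub>R (\<Sum>j=1..s. (\<mu> j * impulse \<nu> i j) *\<^sub>R F j)"
  using \<open>i \<le> s\<close>
proof (induction i rule: induct_nat_012)
  case 0
  show ?case by simp
next
  case 1
  have "(\<Sum>j=1..s. (\<mu> j * impulse \<nu> (Suc 0) j) *\<^sub>R F j)
      = (\<Sum>j=1..s. if j = 1 then \<mu> 1 *\<^sub>R F 1 else 0)"
    by (rule sum.cong) auto
  also have "\<dots> = \<mu> 1 *\<^sub>R F 1" using 1 by simp
  finally show ?case using Y1 by (simp add: mult.commute)
next
  case (ge2 i)
  let ?S = "\<lambda>i. (\<Sum>j=1..s. (\<mu> j * impulse \<nu> i j) *\<^sub>R F j)"
  have "?S (Suc (Suc i)) = (\<Sum>j=1..s. (if j = i + 2 then \<mu> (i + 2) *\<^sub>R F (i + 2) else 0)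
      + \<nu> (i + 2) *\<^sub>R ((\<mu> j * impulse \<nu> (Suc i) j) *\<^sub>R F j)
      + (1 - \<nu> (i + 2)) *\<^sub>R ((\<mu> j * impulse \<nu> i j) *\<^sub>R F j))"
    by (rule sum.cong) (auto simp: algebra_simps)
  also have "\<dots> = \<mu> (i + 2) *\<^sub>R F (i + 2) + \<nu> (i + 2) *\<^sub>R ?S (Suc i)
      + (1 - \<nu> (i + 2)) *\<^sub>R ?S i"
    using ge2.prems by (simp add: sum.distrib scaleR_sum_right)
  finally have S: "?S (Suc (Suc i)) = \<dots>" .
  have "Y (Suc (Suc i)) = (\<mu> (i + 2) * h) *\<^sub>R F (i + 2) + \<nu> (i + 2) *\<^sub>R (Y 0 + h *\<^sub>R ?S (Suc i))
      + (1 - \<nu> (i + 2)) *\<^sub>R (Y 0 + h *\<^sub>R ?S i)"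
    using Y2[of "i + 2"] ge2 by simp
  also have "\<dots> = Y 0 + h *\<^sub>R ?S (Suc (Suc i))"
    unfolding S by (simp add: algebra_simps)
  finally show ?case .
qed

section \<open>The adjoint of a three-term recursion\<close>

text \<open>
  This is \<open>\<alpha> i\<close> times the \<open>i\<close>-th double adjoint stage, with \<open>\<alpha> i = c * C s i\<close> inserted. In this
  form it makes sense for \<open>i = 0\<close> and \<open>i = s + 1\<close> as well, which removes the special cases at both
  ends.
\<close>

definition scaled_costate ::
  "(nat \<Rightarrow> real) \<Rightarrow> (nat \<Rightarrow> real) \<Rightarrow> nat \<Rightarrow> real \<Rightarrow> real \<Rightarrow> (nat \<Rightarrow> 'v::real_vector) \<Rightarrow> 'v \<Rightarrow> nat \<Rightarrow> 'v"
  where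
  "scaled_costate \<nu> w s c h g p i =
     (c * impulse \<nu> s i) *\<^sub>R p + h *\<^sub>R (\<Sum>j=1..s. (w j * impulse \<nu> (j - 1) i) *\<^sub>R g j)"

lemma scaled_costate_last: "scaled_costate \<nu> w s c h g p s = c *\<^sub>R p"
proof -
  have "(\<Sum>j=1..s. (w j * impulse \<nu> (j - 1) s) *\<^sub>R g j) = 0"
    by (intro sum.neutral) (auto simp: impulse_eq_0)
  then show ?thesis by (simp add: scaled_costate_def impulse_diag)
qed

lemma scaled_costate_beyond: "scaled_costate \<nu> w s c h g p (Suc s) = 0"
proof -
  have "(\<Sum>j=1..s. (w j * impulse \<nu> (j - 1) (Suc s)) *\<^sub>R g j) = 0"
    by (intro sum.neutral) (auto simp: impulse_eq_0)
  then show ?thesis by (simp add: scaled_costate_def impulse_eq_0)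
qed

text \<open>
  A column identity with one Kronecker term passes to scaled costates; the Kronecker term at row
  \<open>j - 1 = i\<close> selects \<open>g (i + 1)\<close>. The factor \<open>v\<close> covers the two cases \<open>\<nu> (i + 1)\<close> and \<open>1\<close>.
\<close>

lemma scaled_costate_recursion_aux:
  assumes col: "\<And>r. impulse \<nu> r i = (if r = i then 1 else 0)
                  + v * impulse \<nu> r (i + 1) + (1 - \<nu> (i + 2)) * impulse \<nu> r (i + 2)"
    and "i < s"
  shows "scaled_costate \<nu> w s c h g p i = (h * w (i + 1)) *\<^sub>R g (i + 1)
           + v *\<^sub>R scaled_costate \<nu> w s c h g p (i + 1)
           + (1 - \<nu> (i + 2)) *\<^sub>R scaled_costate \<nu> w s c h g p (i + 2)"
proof -
  let ?S = "\<lambda>i. (\<Sum>j=1..s. (w j * impulse \<nu> (j - 1) i) *\<^sub>R g j)"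
  have "?S i = (\<Sum>j=1..s. (if j = i + 1 then w (i + 1) *\<^sub>R g (i + 1) else 0)
      + v *\<^sub>R ((w j * impulse \<nu> (j - 1) (i + 1)) *\<^sub>R g j)
      + (1 - \<nu> (i + 2)) *\<^sub>R ((w j * impulse \<nu> (j - 1) (i + 2)) *\<^sub>R g j))"
  proof (rule sum.cong[OF refl])
    fix j assume "j \<in> {1..s}"
    then have "(j - 1 = i) = (j = i + 1)" by auto
    then show "(w j * impulse \<nu> (j - 1) i) *\<^sub>R g j
      = (if j = i + 1 then w (i + 1) *\<^sub>R g (i + 1) else 0)
      + v *\<^sub>R ((w j * impulse \<nu> (j - 1) (i + 1)) *\<^sub>R g j)
      + (1 - \<nu> (i + 2)) *\<^sub>R ((w j * impulse \<nu> (j - 1) (i + 2)) *\<^sub>R g j)"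
      unfolding col[of "j - 1"] by (simp add: algebra_simps)
  qed
  also have "\<dots> = w (i + 1) *\<^sub>R g (i + 1) + v *\<^sub>R ?S (i + 1) + (1 - \<nu> (i + 2)) *\<^sub>R ?S (i + 2)"
    using \<open>i < s\<close> by (simp add: sum.distrib scaleR_sum_right)
  finally have S: "?S i = \<dots>" .
  have C: "impulse \<nu> s i = v * impulse \<nu> s (i + 1) + (1 - \<nu> (i + 2)) * impulse \<nu> s (i + 2)"
    using col[of s] \<open>i < s\<close> by simp
  show ?thesis
    unfolding scaled_costate_def S C by (simp add: algebra_simps)
qed

lemma scaled_costate_recursion:
  assumes "1 \<le> i" "i < s"
  shows "scaled_costate \<nu> w s c h g p i = (h * w (i + 1)) *\<^sub>R g (i + 1)
           + \<nu> (i + 1) *\<^sub>R scaled_costate \<nu> w s c h g p (i + 1)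
           + (1 - \<nu> (i + 2)) *\<^sub>R scaled_costate \<nu> w s c h g p (i + 2)"
  using assms impulse_column_recursion by (intro scaled_costate_recursion_aux)

lemma scaled_costate_recursion_0:
  assumes "0 < s"
  shows "scaled_costate \<nu> w s c h g p 0 = (h * w 1) *\<^sub>R g 1
           + scaled_costate \<nu> w s c h g p 1
           + (1 - \<nu> 2) *\<^sub>R scaled_costate \<nu> w s c h g p 2"
  using scaled_costate_recursion_aux[of \<nu> 0 1, OF _ assms, of w c h g p]
    impulse_column_recursion_0[of _ \<nu>]
  by (simp add: impulse_0 numeral_2_eq_2)

text \<open>
  The recurrence and its starting value determine the stages \<open>P s, \<dots>, P 1\<close> successively, and the
  double adjoint stages solve it, so the two descriptions agree; the \<open>g j\<close> are arbitrary here.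
  The recurrence is cleared of denominators. The step from \<open>s\<close> to \<open>s - 1\<close> is separate because
  only one previous stage exists there.
\<close>

lemma stages_eq_scaled_costate_iff:
  fixes P g :: "nat \<Rightarrow> 'v::real_vector"
  assumes "s \<ge> 2"
    and w: "\<And>i. i \<in> {1..s} \<Longrightarrow> w i = \<mu> i * \<alpha> i"
    and \<alpha>: "\<And>i. i \<in> {1..s} \<Longrightarrow> \<alpha> i = \<alpha> s * impulse \<nu> s i"
    and nz: "\<And>i. i \<in> {1..s} \<Longrightarrow> \<alpha> i \<noteq> 0"
  shows "(\<forall>i\<in>{1..s}. \<alpha> i *\<^sub>R P i = scaled_costate \<nu> w s (\<alpha> s) h g p i) \<longleftrightarrow>
     P s = p
     \<and> \<alpha> (s - 1) *\<^sub>R P (s - 1) = (\<mu> s * \<alpha> s * h) *\<^sub>R g s + (\<nu> s * \<alpha> s) *\<^sub>R P s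
     \<and> (\<forall>i. 1 \<le> i \<and> i + 2 \<le> s \<longrightarrow> \<alpha> i *\<^sub>R P i = (\<mu> (i + 1) * \<alpha> (i + 1) * h) *\<^sub>R g (i + 1)
           + (\<nu> (i + 1) * \<alpha> (i + 1)) *\<^sub>R P (i + 1)
           + ((1 - \<nu> (i + 2)) * \<alpha> (i + 2)) *\<^sub>R P (i + 2))"
    (is "?L \<longleftrightarrow> ?R")
proof -
  let ?Q = "scaled_costate \<nu> w s (\<alpha> s) h g p"
  have Q1: "?Q (s - 1) = (\<mu> s * \<alpha> s * h) *\<^sub>R g s + \<nu> s *\<^sub>R ?Q s"
    using scaled_costate_recursion[of "s - 1" s \<nu> w "\<alpha> s" h g p] \<open>s \<ge> 2\<close> w[of s]
    by (simp add: scaled_costate_beyond mult.commute)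
  have Q2: "?Q i = (\<mu> (i + 1) * \<alpha> (i + 1) * h) *\<^sub>R g (i + 1)
           + \<nu> (i + 1) *\<^sub>R ?Q (i + 1) + (1 - \<nu> (i + 2)) *\<^sub>R ?Q (i + 2)"
    if "1 \<le> i" "i + 2 \<le> s" for i
    using scaled_costate_recursion[of i s \<nu> w "\<alpha> s" h g p] that w[of "i + 1"]
    by (simp add: mult.commute)
  show ?thesis
  proof
    assume L: ?L
    have Ps: "P s = p"
      using bspec[OF L, of s] nz[of s] \<open>s \<ge> 2\<close> by (simp add: scaled_costate_last)
    show ?R
    proof (intro conjI allI impI)
      show "P s = p" by (fact Ps)
      have "\<alpha> (s - 1) *\<^sub>R P (s - 1) = ?Q (s - 1)" using L \<open>s \<ge> 2\<close> by simp
      then show "\<alpha> (s - 1) *\<^sub>R P (s - 1) = (\<mu> s * \<alpha> s * h) *\<^sub>R g s + (\<nu> s * \<alpha> s) *\<^sub>R P s"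
        unfolding Q1 Ps by (simp add: scaled_costate_last)
    next
      fix i assume i: "1 \<le> i \<and> i + 2 \<le> s"
      have "\<alpha> i *\<^sub>R P i = ?Q i" "\<alpha> (i + 1) *\<^sub>R P (i + 1) = ?Q (i + 1)"
        "\<alpha> (i + 2) *\<^sub>R P (i + 2) = ?Q (i + 2)"
        using L i by simp_all
      with Q2[of i] i show "\<alpha> i *\<^sub>R P i = (\<mu> (i + 1) * \<alpha> (i + 1) * h) *\<^sub>R g (i + 1)
           + (\<nu> (i + 1) * \<alpha> (i + 1)) *\<^sub>R P (i + 1)
           + ((1 - \<nu> (i + 2)) * \<alpha> (i + 2)) *\<^sub>R P (i + 2)"
        by (metis scaleR_scaleR)
    qed
  next
    assume R: ?R
    have "\<alpha> i *\<^sub>R P i = ?Q i" if "1 \<le> i" "i \<le> s" for i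
      using that
    proof (induction "s - i" arbitrary: i rule: less_induct)
      case less
      consider "i = s" | "i = s - 1" "i < s" | "i + 2 \<le> s" using less.prems by linarith
      then show ?case
      proof cases
        case 1
        then show ?thesis using R by (simp add: scaled_costate_last)
      next
        case 2
        then show ?thesis using R Q1 by (simp add: scaled_costate_last)
      next
        case 3
        have "\<alpha> (i + 1) *\<^sub>R P (i + 1) = ?Q (i + 1)" "\<alpha> (i + 2) *\<^sub>R P (i + 2) = ?Q (i + 2)"
          using less.hyps[of "i + 1"] less.hyps[of "i + 2"] 3 by auto
        then show ?thesis using R Q2[OF less.prems(1) 3] less.prems(1) 3
          by (metis scaleR_scaleR)
      qed
    qed
    then show ?L by simp
  qed
qed

section \<open>Chebyshev polynomials to the right of one\<close>

lemma cheb_0: "cheb 0 = 1"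
  by (rule cheb_unique) (simp add: cheb_cos)

lemma cheb_1: "cheb (Suc 0) = [:0, 1:]"
  by (rule cheb_unique) (simp add: cheb_cos)

lemma cheb_recursion: "cheb (Suc (Suc n)) = [:0, 2:] * cheb (Suc n) - cheb n"
proof (rule cheb_unique)
  fix \<theta> :: real
  have "cos (real (Suc n) * \<theta> + \<theta>) + cos (real (Suc n) * \<theta> - \<theta>)
      = 2 * cos \<theta> * cos (real (Suc n) * \<theta>)"
    by (simp add: cos_add cos_diff)
  moreover have "real (Suc n) * \<theta> + \<theta> = real (Suc (Suc n)) * \<theta>"
    and "real (Suc n) * \<theta> - \<theta> = real n * \<theta>"
    by (simp_all add: algebra_simps)
  ultimately show
    "poly (cheb (Suc (Suc n))) (cos \<theta>) = poly ([:0, 2:] * cheb (Suc n) - cheb n) (cos \<theta>)"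
    by (simp add: cheb_cos)
qed

text \<open>
  For \<open>x \<ge> 1\<close> a sequence with \<open>a (n + 2) \<ge> 2 x a (n + 1) - a n\<close> keeps growing once it grows, since
  \<open>2 x a - b \<ge> a\<close> for \<open>a \<ge> b, a \<ge> 0\<close>. The values of the polynomials satisfy this recursion, and
  those of the derivatives satisfy it with an added multiple of the preceding, nonnegative ones.
\<close>

lemma cheb_mono:
  assumes "1 \<le> (x::real)"
  shows "1 \<le> poly (cheb n) x \<and> poly (cheb n) x \<le> poly (cheb (Suc n)) x"
proof (induction n)
  case 0
  then show ?case using assms by (simp add: cheb_0 cheb_1)
next
  case (Suc n)
  have "1 * poly (cheb (Suc n)) x \<le> x * poly (cheb (Suc n)) x"
    using Suc assms by (intro mult_right_mono) auto
  moreover have "poly (cheb (Suc (Suc n))) x = 2 * (x * poly (cheb (Suc n)) x) - poly (cheb n) x"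
    by (simp add: cheb_recursion)
  ultimately show ?case using Suc by linarith
qed

lemma pderiv_cheb_mono:
  assumes "1 \<le> (x::real)"
  shows "0 \<le> poly (pderiv (cheb n)) x
    \<and> poly (pderiv (cheb n)) x + 1 \<le> poly (pderiv (cheb (Suc n))) x"
proof (induction n)
  case 0
  then show ?case by (simp add: cheb_0 cheb_1 pderiv_pCons)
next
  case (Suc n)
  have "1 * poly (pderiv (cheb (Suc n))) x \<le> x * poly (pderiv (cheb (Suc n))) x"
    using Suc assms by (intro mult_right_mono) auto
  moreover have "poly (pderiv (cheb (Suc (Suc n)))) x = 2 * poly (cheb (Suc n)) x
      + 2 * (x * poly (pderiv (cheb (Suc n))) x) - poly (pderiv (cheb n)) x"
    by (simp add: cheb_recursion pderiv_diff pderiv_mult pderiv_pCons pderiv_smult)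
  moreover note cheb_mono[OF assms, of "Suc n"]
  ultimately show ?case using Suc by linarith
qed

lemma pderiv2_cheb_mono:
  assumes "1 \<le> (x::real)"
  shows "0 \<le> poly (pderiv (pderiv (cheb n))) x
    \<and> poly (pderiv (pderiv (cheb n))) x \<le> poly (pderiv (pderiv (cheb (Suc n)))) x
    \<and> 0 < poly (pderiv (pderiv (cheb (Suc (Suc n))))) x"
proof -
  have rec: "poly (pderiv (pderiv (cheb (Suc (Suc n))))) x = 4 * poly (pderiv (cheb (Suc n))) x
      + 2 * x * poly (pderiv (pderiv (cheb (Suc n)))) x - poly (pderiv (pderiv (cheb n))) x" for n
    by (simp add: cheb_recursion pderiv_diff pderiv_mult pderiv_pCons pderiv_add pderiv_smult)
  have pos: "0 < poly (pderiv (cheb (Suc n))) x" for n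
    using pderiv_cheb_mono[OF assms, of n] by linarith
  have growth: "poly (pderiv (pderiv (cheb (Suc n)))) x < poly (pderiv (pderiv (cheb (Suc (Suc n))))) x"
    if "0 \<le> poly (pderiv (pderiv (cheb n))) x"
      "poly (pderiv (pderiv (cheb n))) x \<le> poly (pderiv (pderiv (cheb (Suc n)))) x" for n
  proof -
    have "1 * poly (pderiv (pderiv (cheb (Suc n)))) x \<le> x * poly (pderiv (pderiv (cheb (Suc n)))) x"
      using that assms by (intro mult_right_mono) auto
    with that pos[of n] rec[of n] show ?thesis by linarith
  qed
  have mono: "0 \<le> poly (pderiv (pderiv (cheb n))) x
    \<and> poly (pderiv (pderiv (cheb n))) x \<le> poly (pderiv (pderiv (cheb (Suc n)))) x"
  proof (induction n)
    case 0
    then show ?case by (simp add: cheb_0 cheb_1 pderiv_pCons)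
  next
    case (Suc n)
    then show ?case using growth[of n] by linarith
  qed
  with growth[of n] show ?thesis by linarith
qed

section \<open>The RKC coefficients\<close>

lemma \<omega>\<^sub>0_ge_1: "0 \<le> \<eta> \<Longrightarrow> 1 \<le> \<omega>\<^sub>0 s \<eta>"
  by (simp add: \<omega>\<^sub>0_def)

lemma chebT_pos: "0 \<le> \<eta> \<Longrightarrow> 0 < chebT s \<eta> j"
  using cheb_mono[OF \<omega>\<^sub>0_ge_1, of \<eta> j s] by (simp add: chebT_def)

lemma chebT'_pos:
  assumes "0 \<le> \<eta>" "1 \<le> s"
  shows "0 < chebT' s \<eta>"
  using pderiv_cheb_mono[OF \<omega>\<^sub>0_ge_1[OF assms(1)], of "s - 1" s] assms(2)
  by (simp add: chebT'_def)

lemma chebT''_pos: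
  assumes "0 \<le> \<eta>" "2 \<le> s"
  shows "0 < chebT'' s \<eta>"
proof -
  have "Suc (Suc (s - 2)) = s" using assms(2) by simp
  then show ?thesis
    using pderiv2_cheb_mono[OF \<omega>\<^sub>0_ge_1[OF assms(1)], of "s - 2" s] by (simp add: chebT''_def)
qed

lemma rkc_\<mu>_pos:
  assumes "0 \<le> \<eta>" "2 \<le> s"
  shows "0 < rkc_\<mu> s \<eta> i"
  using chebT''_pos[OF assms] chebT'_pos[of \<eta> s] \<omega>\<^sub>0_ge_1[OF assms(1), of s] chebT_pos[OF assms(1)]
    assms
  by (auto simp: rkc_\<mu>_def \<omega>\<^sub>2_def)

lemma rkc_b_pos:
  assumes "0 \<le> \<eta>" "2 \<le> s"
  shows "0 < rkc_b s \<eta>"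
  using chebT''_pos[OF assms] chebT'_pos[of \<eta> s] assms by (simp add: rkc_b_def)

lemma one_minus_rkc_\<nu>:
  assumes "0 \<le> \<eta>"
  shows "1 - rkc_\<nu> s \<eta> (i + 2) = - chebT s \<eta> i / chebT s \<eta> (i + 2)"
proof -
  have "chebT s \<eta> (i + 2) = 2 * \<omega>\<^sub>0 s \<eta> * chebT s \<eta> (i + 1) - chebT s \<eta> i"
    by (simp add: chebT_def cheb_recursion)
  moreover have "1 - rkc_\<nu> s \<eta> (i + 2)
      = (chebT s \<eta> (i + 2) - 2 * \<omega>\<^sub>0 s \<eta> * chebT s \<eta> (i + 1)) / chebT s \<eta> (i + 2)"
    using chebT_pos[OF assms, of s "i + 2"] by (simp add: rkc_\<nu>_def diff_divide_distrib)
  ultimately show ?thesis by simp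
qed

lemma rkc_stage_eq_impulse:
  assumes "1 \<le> j"
  shows "rkc_stage s \<eta> i j = rkc_\<mu> s \<eta> j * impulse (rkc_\<nu> s \<eta>) i j"
  using assms by (induction i rule: induct_nat_012) (auto simp: algebra_simps)

text \<open>
  With \<open>\<beta> i = \<alpha> i / T\<^sub>i(\<omega>\<^sub>0)\<close> the recursion for \<open>\<alpha>\<close> reads
  \<open>\<beta> i = 2 \<omega>\<^sub>0 \<beta> (i + 1) - \<beta> (i + 2)\<close>, because \<open>\<nu> (i + 1)\<close> and \<open>1 - \<nu> (i + 2)\<close> carry the common factor \<open>T\<^sub>i(\<omega>\<^sub>0)\<close>. As \<open>\<omega>\<^sub>0 \<ge> 1\<close>, the
  sequence \<open>\<beta>\<close> cannot decrease as \<open>i\<close> goes down from \<open>s\<close>.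
\<close>

lemma rkc_alpha_pos:
  assumes "0 \<le> \<eta>" and "2 \<le> s"
    and "0 < \<alpha> s"
    and last: "\<alpha> (s - 1) = rkc_\<nu> s \<eta> s * \<alpha> s"
    and rec: "\<And>i. 1 \<le> i \<Longrightarrow> i + 2 \<le> s \<Longrightarrow>
        \<alpha> i = rkc_\<nu> s \<eta> (i + 1) * \<alpha> (i + 1) + (1 - rkc_\<nu> s \<eta> (i + 2)) * \<alpha> (i + 2)"
    and "1 \<le> i" "i \<le> s"
  shows "0 < \<alpha> i"
proof -
  define \<beta> where "\<beta> i = \<alpha> i / chebT s \<eta> i" for i
  note T = chebT_pos[OF \<open>0 \<le> \<eta>\<close>, of s]
  have T0: "chebT s \<eta> j \<noteq> 0" for j using T[of j] by simp
  note x1 = \<omega>\<^sub>0_ge_1[OF \<open>0 \<le> \<eta>\<close>, of s]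
  have \<beta>_last: "\<beta> (s - 1) = 2 * \<omega>\<^sub>0 s \<eta> * \<beta> s"
    using last T0 by (simp add: \<beta>_def rkc_\<nu>_def)
  have \<beta>_rec: "\<beta> i = 2 * \<omega>\<^sub>0 s \<eta> * \<beta> (i + 1) - \<beta> (i + 2)" if "1 \<le> i" "i + 2 \<le> s" for i
  proof -
    have "\<alpha> i = chebT s \<eta> i * (2 * \<omega>\<^sub>0 s \<eta> * \<beta> (i + 1) - \<beta> (i + 2))"
      unfolding rec[OF that] one_minus_rkc_\<nu>[OF \<open>0 \<le> \<eta>\<close>]
      by (simp add: \<beta>_def rkc_\<nu>_def algebra_simps)
    then show ?thesis using T0[of i] unfolding \<beta>_def[of i] by simp
  qed
  have \<beta>s: "0 < \<beta> s" using \<open>0 < \<alpha> s\<close> T by (simp add: \<beta>_def)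
  have grow: "x \<le> 2 * \<omega>\<^sub>0 s \<eta> * x - y" if "0 < x" "y \<le> x" for x y
    using mult_right_mono[OF x1, of x] that by linarith
  have main: "0 < \<beta> (i + 1) \<and> \<beta> (i + 1) \<le> \<beta> i" if "1 \<le> i" "i \<le> s - 1" for i
    using that(2)
  proof (induction rule: inc_induct)
    case base
    show ?case
      using \<beta>s \<beta>_last grow[of "\<beta> s" 0] \<open>2 \<le> s\<close> by simp
  next
    case (step n)
    then show ?case
      using \<beta>_rec[of n] grow[of "\<beta> (n + 1)" "\<beta> (n + 2)"] that(1) by simp
  qed
  have "0 < \<beta> i"
  proof (cases "i = s")
    case True
    then show ?thesis using \<beta>s by simp
  next
    case False
    then have "i \<le> s - 1" using \<open>i \<le> s\<close> by simp
    then show ?thesis using main[OF \<open>1 \<le> i\<close>] by linarith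
  qed
  then show ?thesis using T[of i] by (simp add: \<beta>_def zero_less_divide_iff)
qed

section \<open>The RKC scheme and its double adjoint\<close>

lemma rkc_scheme_imp_rk_scheme:
  assumes "rkc_scheme s \<eta> f N h y\<^sub>0 u y Y"
  shows "rk_scheme s (rkc_A s \<eta>) (rkc_w s \<eta>) f N h y\<^sub>0 u y Y"
  unfolding rk_scheme_def
proof (intro conjI allI impI ballI)
  show "y 0 = y\<^sub>0" using assms by (simp add: rkc_scheme_def)
next
  fix k assume "k < N"
  let ?F = "\<lambda>j. f (u k (j - 1), Y k (j - 1))"
  let ?S = "\<lambda>i. (\<Sum>j=1..s. rkc_stage s \<eta> i j *\<^sub>R ?F j)"
  note D = assms[unfolded rkc_scheme_def, THEN conjunct2, rule_format, OF \<open>k < N\<close>]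
  have Y: "Y k i = y k + h *\<^sub>R ?S i" if "i \<le> s" for i
  proof -
    have "Y k i = Y k 0 + h *\<^sub>R
        (\<Sum>j=1..s. (rkc_\<mu> s \<eta> j * impulse (rkc_\<nu> s \<eta>) i j) *\<^sub>R ?F j)"
      by (rule three_term_superposition[OF _ _ that]) (use D in auto)
    also have "(\<Sum>j=1..s. (rkc_\<mu> s \<eta> j * impulse (rkc_\<nu> s \<eta>) i j) *\<^sub>R ?F j) = ?S i"
      by (rule sum.cong) (auto simp: rkc_stage_eq_impulse)
    finally show ?thesis using D by simp
  qed
  show "Y k (i - 1) = y k + h *\<^sub>R (\<Sum>j=1..s. rkc_A s \<eta> i j *\<^sub>R ?F j)" if "i \<in> {1..s}" for i
    using Y[of "i - 1"] that unfolding rkc_A_def by (meson diff_le_self atLeastAtMost_iff le_trans)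
  let ?c = "rkc_b s \<eta> * chebT s \<eta> s"
  have w: "(\<Sum>i=1..s. rkc_w s \<eta> i *\<^sub>R ?F i) = ?c *\<^sub>R ?S s"
    by (simp add: rkc_w_def scaleR_sum_right mult.assoc)
  have "y (Suc k) = (1 - ?c) *\<^sub>R y k + ?c *\<^sub>R (y k + h *\<^sub>R ?S s)"
    using D Y[of s] by (simp add: rkc_a_def)
  also have "\<dots> = y k + h *\<^sub>R (?c *\<^sub>R ?S s)" by (simp add: algebra_simps)
  finally show "y (Suc k) = y k + h *\<^sub>R (\<Sum>i=1..s. rkc_w s \<eta> i *\<^sub>R ?F i)"
    unfolding w .
qed

lemma stationarity_reindex:
  "double_adjoint_stationarity s f N u Y P \<longleftrightarrow> rkc_stationarity s f N u Y P"
proof -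
  have "(\<forall>i\<in>{1..s}. Q (i - 1) i) \<longleftrightarrow> (\<forall>j\<in>{1..s}. Q (s - j) (s - j + 1))"
    for Q :: "nat \<Rightarrow> nat \<Rightarrow> bool"
  proof
    assume L: "\<forall>i\<in>{1..s}. Q (i - 1) i"
    show "\<forall>j\<in>{1..s}. Q (s - j) (s - j + 1)"
    proof
      fix j assume "j \<in> {1..s}"
      then show "Q (s - j) (s - j + 1)" using L[rule_format, of "s - j + 1"] by auto
    qed
  next
    assume R: "\<forall>j\<in>{1..s}. Q (s - j) (s - j + 1)"
    show "\<forall>i\<in>{1..s}. Q (i - 1) i"
    proof
      fix i assume "i \<in> {1..s}"
      then show "Q (i - 1) i" using R[rule_format, of "s - i + 1"] by auto
    qed
  qed
  from this[of "\<lambda>a b. grad_u_Ham f (u k a) (Y k a) (P k b) = 0" for k] show ?thesis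
    unfolding double_adjoint_stationarity_def rkc_stationarity_def by simp
qed

lemma eq_scaleR_divide_iff:
  fixes x a b c :: "'v::real_vector"
  assumes "\<alpha> \<noteq> 0"
  shows "x = (l / \<alpha> * h) *\<^sub>R a + (m / \<alpha>) *\<^sub>R b + (n / \<alpha>) *\<^sub>R c
    \<longleftrightarrow> \<alpha> *\<^sub>R x = (l * h) *\<^sub>R a + m *\<^sub>R b + n *\<^sub>R c"
proof -
  have "(l * h) *\<^sub>R a + m *\<^sub>R b + n *\<^sub>R c
      = \<alpha> *\<^sub>R ((l / \<alpha> * h) *\<^sub>R a + (m / \<alpha>) *\<^sub>R b + (n / \<alpha>) *\<^sub>R c)"
    using assms by (simp add: scaleR_right_distrib)
  then show ?thesis using assms by simp
qed

text \<open>
  One time step, from \<open>p' = p (k + 1)\<close> to \<open>p = p k\<close>. The stages are compared after multiplication by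
  \<open>\<alpha> i\<close>. The value \<open>p\<close> is the scaled costate of index \<open>0\<close>, whose weight is \<open>\<alpha> s\<close>, completed by
  \<open>a p'\<close> with \<open>a = 1 - \<alpha> s\<close>.
\<close>

lemma rkc_adjoint_step_iff:
  fixes P g :: "nat \<Rightarrow> 'v::real_vector" and \<alpha> :: "nat \<Rightarrow> real"
  assumes s: "s \<ge> 2"
    and \<alpha>s: "\<alpha> s = rkc_b s \<eta> * chebT s \<eta> s"
    and last: "\<alpha> (s - 1) = rkc_\<nu> s \<eta> s * \<alpha> s"
    and \<alpha>: "\<And>i. i \<in> {1..s} \<Longrightarrow> \<alpha> i = \<alpha> s * impulse (rkc_\<nu> s \<eta>) s i"
    and w: "\<And>i. i \<in> {1..s} \<Longrightarrow> rkc_w s \<eta> i = rkc_\<mu> s \<eta> i * \<alpha> i"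
    and \<mu>: "\<And>i. i \<in> {1..s} \<Longrightarrow> rkc_\<mu> s \<eta> i \<noteq> 0"
    and nz: "\<And>i. i \<in> {1..s} \<Longrightarrow> \<alpha> i \<noteq> 0"
  shows "p = p' + h *\<^sub>R (\<Sum>i=1..s. rkc_w s \<eta> i *\<^sub>R g i)
      \<and> (\<forall>i\<in>{1..s}. P i = p' + h *\<^sub>R
            (\<Sum>j=1..s. (rkc_w s \<eta> j / rkc_w s \<eta> i * rkc_A s \<eta> j i) *\<^sub>R g j))
      \<and> P 0 = p
    \<longleftrightarrow> P s = p'
      \<and> P (s - 1) = P s + (rkc_\<mu> s \<eta> s / rkc_\<nu> s \<eta> s * h) *\<^sub>R g s
      \<and> (\<forall>j\<in>{2..s-1}. P (s - j) =
            (rkc_\<mu> s \<eta> (s - j + 1) * \<alpha> (s - j + 1) / \<alpha> (s - j) * h) *\<^sub>R g (s - j + 1)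
          + (rkc_\<nu> s \<eta> (s - j + 1) * \<alpha> (s - j + 1) / \<alpha> (s - j)) *\<^sub>R P (s - j + 1)
          + ((1 - rkc_\<nu> s \<eta> (s - j + 2)) * \<alpha> (s - j + 2) / \<alpha> (s - j)) *\<^sub>R P (s - j + 2))
      \<and> P 0 = (rkc_\<mu> s \<eta> 1 * \<alpha> 1 * h) *\<^sub>R g 1 + \<alpha> 1 *\<^sub>R P 1
          + ((1 - rkc_\<nu> s \<eta> 2) * \<alpha> 2) *\<^sub>R P 2 + rkc_a s \<eta> *\<^sub>R p'
      \<and> p = P 0"
    (is "?p \<and> ?stages \<and> P 0 = p \<longleftrightarrow> ?Ps \<and> ?Plast \<and> ?Prec \<and> ?P0 \<and> p = P 0")
proof -
  let ?\<nu> = "rkc_\<nu> s \<eta>" and ?\<mu> = "rkc_\<mu> s \<eta>" and ?w = "rkc_w s \<eta>"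
  let ?Q = "scaled_costate ?\<nu> ?w s (\<alpha> s) h g p'"
  have stage: "P i = p' + h *\<^sub>R (\<Sum>j=1..s. (?w j / ?w i * rkc_A s \<eta> j i) *\<^sub>R g j)
      \<longleftrightarrow> \<alpha> i *\<^sub>R P i = ?Q i" if i: "i \<in> {1..s}" for i
  proof -
    have "?Q i = \<alpha> i *\<^sub>R p' + h *\<^sub>R (\<Sum>j=1..s. (?w j * impulse ?\<nu> (j - 1) i) *\<^sub>R g j)"
      using \<alpha>[OF i] by (simp add: scaled_costate_def)
    also have "(\<Sum>j=1..s. (?w j * impulse ?\<nu> (j - 1) i) *\<^sub>R g j)
        = (\<Sum>j=1..s. \<alpha> i *\<^sub>R ((?w j / ?w i * rkc_A s \<eta> j i) *\<^sub>R g j))"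
      using i nz[OF i] \<mu>[OF i]
      by (intro sum.cong) (auto simp: rkc_A_def rkc_stage_eq_impulse w[OF i])
    also have "\<alpha> i *\<^sub>R p' + h *\<^sub>R \<dots>
        = \<alpha> i *\<^sub>R (p' + h *\<^sub>R (\<Sum>j=1..s. (?w j / ?w i * rkc_A s \<eta> j i) *\<^sub>R g j))"
      by (simp only: scaleR_right_distrib scaleR_sum_right scaleR_left_commute)
    finally show ?thesis using nz[OF i] by simp
  qed
  have "?\<nu> s \<noteq> 0" using nz[of "s - 1"] last s by auto
  have Plast: "?Plast \<longleftrightarrow>
      \<alpha> (s - 1) *\<^sub>R P (s - 1) = (?\<mu> s * \<alpha> s * h) *\<^sub>R g s + (?\<nu> s * \<alpha> s) *\<^sub>R P s"
  proof -
    have "(?\<mu> s * \<alpha> s * h) *\<^sub>R g s + (?\<nu> s * \<alpha> s) *\<^sub>R P s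
        = \<alpha> (s - 1) *\<^sub>R (P s + (?\<mu> s / ?\<nu> s * h) *\<^sub>R g s)"
      unfolding last using \<open>?\<nu> s \<noteq> 0\<close> by (simp add: scaleR_right_distrib mult_ac)
    then show ?thesis using nz[of "s - 1"] s by simp
  qed
  have Prec: "?Prec \<longleftrightarrow> (\<forall>i. 1 \<le> i \<and> i + 2 \<le> s \<longrightarrow>
         \<alpha> i *\<^sub>R P i = (?\<mu> (i + 1) * \<alpha> (i + 1) * h) *\<^sub>R g (i + 1)
           + (?\<nu> (i + 1) * \<alpha> (i + 1)) *\<^sub>R P (i + 1)
           + ((1 - ?\<nu> (i + 2)) * \<alpha> (i + 2)) *\<^sub>R P (i + 2))" (is "_ \<longleftrightarrow> (\<forall>i. _ \<longrightarrow> ?E i)")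
  proof -
    have "?Prec \<longleftrightarrow> (\<forall>j\<in>{2..s-1}. ?E (s - j))"
      using nz by (intro ball_cong refl eq_scaleR_divide_iff) auto
    also have "\<dots> \<longleftrightarrow> (\<forall>i. 1 \<le> i \<and> i + 2 \<le> s \<longrightarrow> ?E i)"
    proof (intro iffI allI impI ballI)
      fix i assume E: "\<forall>j\<in>{2..s-1}. ?E (s - j)" and i: "1 \<le> i \<and> i + 2 \<le> s"
      then have "s - i \<in> {2..s-1}" and *: "s - (s - i) = i" by auto
      from E[rule_format, OF this(1)] show "?E i" unfolding * .
    next
      fix j assume "\<forall>i. 1 \<le> i \<and> i + 2 \<le> s \<longrightarrow> ?E i" "j \<in> {2..s-1}"
      moreover from this have "1 \<le> s - j \<and> s - j + 2 \<le> s" by auto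
      ultimately show "?E (s - j)" by blast
    qed
    finally show ?thesis .
  qed
  have stages: "?stages \<longleftrightarrow> ?Ps \<and> ?Plast \<and> ?Prec"
  proof -
    have "?stages \<longleftrightarrow> (\<forall>i\<in>{1..s}. \<alpha> i *\<^sub>R P i = ?Q i)"
      using stage by (intro ball_cong) auto
    also have "\<dots> \<longleftrightarrow> ?Ps \<and> ?Plast \<and> ?Prec"
      unfolding Plast Prec by (rule stages_eq_scaled_costate_iff[OF s w \<alpha> nz])
    finally show ?thesis .
  qed
  have P0: "?P0 \<longleftrightarrow> P 0 = p' + h *\<^sub>R (\<Sum>i=1..s. ?w i *\<^sub>R g i)" if st: ?stages
  proof -
    have Q12: "\<alpha> 1 *\<^sub>R P 1 = ?Q 1" "\<alpha> 2 *\<^sub>R P 2 = ?Q 2"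
      using st stage[of 1] stage[of 2] s by auto
    have w1: "?\<mu> 1 * \<alpha> 1 * h = h * ?w 1" using w[of 1] s by simp
    have "(?\<mu> 1 * \<alpha> 1 * h) *\<^sub>R g 1 + \<alpha> 1 *\<^sub>R P 1 + ((1 - ?\<nu> 2) * \<alpha> 2) *\<^sub>R P 2
        = (h * ?w 1) *\<^sub>R g 1 + ?Q 1 + (1 - ?\<nu> 2) *\<^sub>R ?Q 2"
      unfolding w1 Q12[symmetric] by simp
    also have "\<dots> = ?Q 0"
      using scaled_costate_recursion_0[of s ?\<nu> ?w "\<alpha> s" h g p'] s by simp
    also have "\<dots> = \<alpha> s *\<^sub>R p' + h *\<^sub>R (\<Sum>i=1..s. ?w i *\<^sub>R g i)"
      by (simp add: scaled_costate_def impulse_0)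
    finally have "(?\<mu> 1 * \<alpha> 1 * h) *\<^sub>R g 1 + \<alpha> 1 *\<^sub>R P 1 + ((1 - ?\<nu> 2) * \<alpha> 2) *\<^sub>R P 2
        + rkc_a s \<eta> *\<^sub>R p' = p' + h *\<^sub>R (\<Sum>i=1..s. ?w i *\<^sub>R g i)"
      by (simp add: rkc_a_def \<alpha>s algebra_simps)
    then show ?thesis by simp
  qed
  show ?thesis
  proof
    assume L: "?p \<and> ?stages \<and> P 0 = p"
    then have st: ?stages by (elim conjE)
    have "P 0 = p' + h *\<^sub>R (\<Sum>i=1..s. ?w i *\<^sub>R g i)"
      using L by (elim conjE) (rule trans)
    with P0[OF st] have ?P0 by (rule iffD2)
    moreover have "p = P 0" using L by (elim conjE) (rule sym)
    ultimately show "?Ps \<and> ?Plast \<and> ?Prec \<and> ?P0 \<and> p = P 0"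
      using stages[THEN iffD1, OF st] by (elim conjE) (intro conjI)
  next
    assume R: "?Ps \<and> ?Plast \<and> ?Prec \<and> ?P0 \<and> p = P 0"
    then have "?Ps \<and> ?Plast \<and> ?Prec" by (elim conjE) (intro conjI)
    with stages have st: ?stages by (rule iffD2)
    have P0_eq: "P 0 = p' + h *\<^sub>R (\<Sum>i=1..s. ?w i *\<^sub>R g i)"
      using P0[OF st] R by (elim conjE) (rule iffD1)
    have p: "p = P 0" using R by (elim conjE)
    show "?p \<and> ?stages \<and> P 0 = p"
      using trans[OF p P0_eq] st p[symmetric] by (intro conjI)
  qed
qed

theorem theorem3p5:
  fixes T \<eta> h :: real and N s :: nat
    and y\<^sub>0 :: "real^'n"
    and f :: "(real^'m) \<times> (real^'n) \<Rightarrow> real^'n"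
    and \<Psi> :: "real^'n \<Rightarrow> real"
    and u :: "nat \<Rightarrow> nat \<Rightarrow> real^'m"
    and y p :: "nat \<Rightarrow> real^'n"
    and Y P :: "nat \<Rightarrow> nat \<Rightarrow> real^'n"
    and \<alpha> :: "nat \<Rightarrow> real"
  assumes "T > 0" and "N > 0" and "h = T / real N"
    and "smooth f" and "smooth \<Psi>"
    and "s \<ge> 2" and "\<eta> = 0.15"
    and "rkc_scheme s \<eta> f N h y\<^sub>0 u y Y"
    and "\<alpha> s = rkc_b s \<eta> * chebT s \<eta> s"
    and "\<alpha> (s - 1) = rkc_\<nu> s \<eta> s * \<alpha> s"
    and "\<And>j. j \<in> {2..s-1} \<Longrightarrow>
           \<alpha> (s - j) = rkc_\<nu> s \<eta> (s - j + 1) * \<alpha> (s - j + 1)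
                     + (1 - rkc_\<nu> s \<eta> (s - j + 2)) * \<alpha> (s - j + 2)"
  shows "rk_scheme s (rkc_A s \<eta>) (rkc_w s \<eta>) f N h y\<^sub>0 u y Y
    \<and> (\<forall>i\<in>{1..s}. rkc_w s \<eta> i \<noteq> 0) \<and> (\<forall>i\<in>{1..s}. \<alpha> i \<noteq> 0)
    \<and> (double_adjoint_costate s (rkc_A s \<eta>) (rkc_w s \<eta>) f \<Psi> N h u y Y p P
          \<and> (\<forall>k<N. P k 0 = p k)
        \<longleftrightarrow> rkc_costate_recurrence s \<eta> \<alpha> f \<Psi> N h u y Y p P)
    \<and> (double_adjoint_stationarity s f N u Y P \<longleftrightarrow> rkc_stationarity s f N u Y P)"
proof -
  have \<eta>: "0 \<le> \<eta>" using \<open>\<eta> = 0.15\<close> by simp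
  note s = \<open>s \<ge> 2\<close> and \<alpha>s = \<open>\<alpha> s = rkc_b s \<eta> * chebT s \<eta> s\<close>
    and last = \<open>\<alpha> (s - 1) = rkc_\<nu> s \<eta> s * \<alpha> s\<close>
  have rec: "\<alpha> i = rkc_\<nu> s \<eta> (i + 1) * \<alpha> (i + 1) + (1 - rkc_\<nu> s \<eta> (i + 2)) * \<alpha> (i + 2)"
    if "1 \<le> i" "i + 2 \<le> s" for i
  proof -
    have "s - i \<in> {2..s-1}" and "s - (s - i) = i" using that by auto
    then show ?thesis using assms(11)[of "s - i"] by simp
  qed
  have "0 < \<alpha> s" using rkc_b_pos[OF \<eta> s] chebT_pos[OF \<eta>] by (simp add: \<alpha>s)
  then have nz: "\<alpha> i \<noteq> 0" if "i \<in> {1..s}" for i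
    using rkc_alpha_pos[OF \<eta> s, of \<alpha> i] last rec that by simp
  have \<alpha>: "\<alpha> i = \<alpha> s * impulse (rkc_\<nu> s \<eta>) s i" if "i \<in> {1..s}" for i
    using backward_recursion_eq_impulse[of \<alpha> s "rkc_\<nu> s \<eta>" i] last rec that by simp
  have w: "rkc_w s \<eta> i = rkc_\<mu> s \<eta> i * \<alpha> i" if "i \<in> {1..s}" for i
    unfolding \<alpha>[OF that] using that by (simp add: rkc_w_def \<alpha>s rkc_stage_eq_impulse)
  have \<mu>: "rkc_\<mu> s \<eta> i \<noteq> 0" for i using rkc_\<mu>_pos[OF \<eta> s, of i] by simp
  have "double_adjoint_costate s (rkc_A s \<eta>) (rkc_w s \<eta>) f \<Psi> N h u y Y p P
          \<and> (\<forall>k<N. P k 0 = p k)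
        \<longleftrightarrow> rkc_costate_recurrence s \<eta> \<alpha> f \<Psi> N h u y Y p P"
  proof -
    let ?g = "\<lambda>k j. grad_y_Ham f (u k (j - 1)) (Y k (j - 1)) (P k j)"
    have "double_adjoint_costate s (rkc_A s \<eta>) (rkc_w s \<eta>) f \<Psi> N h u y Y p P
          \<and> (\<forall>k<N. P k 0 = p k)
      \<longleftrightarrow> p N = gradient \<Psi> (y N) \<and> (\<forall>k<N.
        p k = p (Suc k) + h *\<^sub>R (\<Sum>i=1..s. rkc_w s \<eta> i *\<^sub>R ?g k i)
        \<and> (\<forall>i\<in>{1..s}. P k i = p (Suc k) + h *\<^sub>R
            (\<Sum>j=1..s. (rkc_w s \<eta> j / rkc_w s \<eta> i * rkc_A s \<eta> j i) *\<^sub>R ?g k j))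
        \<and> P k 0 = p k)"
      unfolding double_adjoint_costate_def by blast
    also have "\<dots> \<longleftrightarrow> rkc_costate_recurrence s \<eta> \<alpha> f \<Psi> N h u y Y p P"
      unfolding rkc_costate_recurrence_def
    proof (rule conj_cong[OF refl], rule all_cong1, rule imp_cong[OF refl], goal_cases)
      case (1 k)
      show ?case
        by (rule rkc_adjoint_step_iff[where s = s and \<eta> = \<eta> and \<alpha> = \<alpha> and h = h
              and g = "?g k" and P = "P k" and p = "p k" and p' = "p (Suc k)",
              unfolded add_diff_cancel_right' diff_self_eq_0, OF s \<alpha>s last \<alpha> w \<mu> nz])
    qed
    finally show ?thesis .
  qed
  then show ?thesis
    using rkc_scheme_imp_rk_scheme[OF assms(8)] stationarity_reindex[of s f N u Y P] nz w \<mu>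
    by simp
qed

end
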